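(* Let $k\ge 1$ and $n\ge 2$ be integers. If $n$ is even, then $$a_{n,k}=1-\sum_{i=2}^{n/2}a_{i,k}\frac{(k!)^i}{(ik)!}.$$ If $n$ is odd, then $$a_{n,k}=1-\sum_{i=2}^{(n-1)/2}a_{i,k}\frac{(k!)^i}{(ik)!}-b_{n,k},\qquad\text{where}\qquad b_{n,k}=\frac{\sum_{P\in\mathcal{M}_{(n+1)/2,k}}\mathrm{mp}_{P,n}}{|\mathcal{F}_{n,k}|}.$$ (Empty sums are $0$.)
   Context: For $n,k\ge 1$, $\mathcal{F}_{n,k}$ is the set of column-strict arrays with $n$ columns and $k$ rows: fillings of a rectangular array with $n$ columns and $k$ rows by the numbers $1,2,\ldots,kn$, each used exactly once, such that the entries increase from bottom to top in each column. Columns are labeled from left to right. If $F$ is a filling of a rectangle with $n$ columns and $k$ rows by distinct positive integers increasing from bottom to top in each column, then $\mathrm{red}(F)\in\mathcal{F}_{n,k}$ is obtained by replacing the $i$th smallest entry of $F$ by $i$, for all $i$. For $F\in\mathcal{F}_{n,k}$ and $1\le c_1<\cdots<c_j\le n$, $F[c_1,\ldots,c_j]$ is the filling with $j$ columns whose $a$th column is column $c_a$ of $F$. For $P\in\mathcal{F}_{j,k}$ and $F\in\mathcal{F}_{n,k}$ with $j\le n$, there is a $P$-match in $F$ starting at position $i$ if $\mathrm{red}(F[i,i+1,\ldots,i+j-1])=P$; $P\text{-mch}(F)$ is the number of $P$-matches in $F$. The pattern $P\in\mathcal{F}_{j,k}$ is minimally overlapping if the smallest $i$ for which there exists $F\in\mathcal{F}_{i,k}$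 with $P\text{-mch}(F)=2$ is $i=2j-1$. $\mathcal{M}_{n,k}$ is the set of minimally overlapping $P\in\mathcal{F}_{n,k}$, $M_{n,k}=|\mathcal{M}_{n,k}|$, and $a_{n,k}=M_{n,k}/|\mathcal{F}_{n,k}|$. For a minimally overlapping $P\in\mathcal{F}_{j,k}$ and $m\ge 1$, $\mathrm{mp}_{P,m(j-1)+1}$ is the number of $F\in\mathcal{F}_{m(j-1)+1,k}$ with $P\text{-mch}(F)=m$ (maximum packings for $P$). In particular, for $n\geq 3$ odd and $P\in\mathcal{M}_{(n+1)/2,k}$, $\mathrm{mp}_{P,n}$ is the number of $F\in\mathcal{F}_{n,k}$ with $P\text{-mch}(F)=2$. *)

theory Defs
  imports Complex_Main
begin

text \<open>An array is the list of its columns from left to right, each column being the list of its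
  entries from bottom to top.\<close>

type_synonym filling = "nat list list"

definition entries :: "filling \<Rightarrow> nat set" where
  "entries F = set (concat F)"

definition column_strict_arrays :: "nat \<Rightarrow> nat \<Rightarrow> filling set" where
  "column_strict_arrays n k =
     {F. length F = n \<and> (\<forall>c \<in> set F. length c = k \<and> sorted_wrt (<) c) \<and>
         distinct (concat F) \<and> entries F = {1..k * n}}"

definition red :: "filling \<Rightarrow> filling" where
  "red F = map (map (\<lambda>x. card {y \<in> entries F. y \<le> x})) F"

text \<open>Columns are numbered from 1.\<close>

definition select_columns :: "filling \<Rightarrow> nat list \<Rightarrow> filling" where
  "select_columns F cs = map (\<lambda>c. F ! (c - 1)) cs"

definition match_at :: "filling \<Rightarrow> filling \<Rightarrow> nat \<Rightarrow> bool" where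
  "match_at P F i \<longleftrightarrow>
     1 \<le> i \<and> i + length P - 1 \<le> length F \<and> red (select_columns F [i..<i + length P]) = P"

definition mch :: "filling \<Rightarrow> filling \<Rightarrow> nat" where
  "mch P F = card {i. match_at P F i}"

definition minimally_overlapping :: "nat \<Rightarrow> filling \<Rightarrow> bool" where
  "minimally_overlapping k P \<longleftrightarrow>
     (\<exists>F \<in> column_strict_arrays (2 * length P - 1) k. mch P F = 2) \<and>
     (\<forall>i \<ge> 1. (\<exists>F \<in> column_strict_arrays i k. mch P F = 2) \<longrightarrow> 2 * length P - 1 \<le> i)"

definition min_overlap_patterns :: "nat \<Rightarrow> nat \<Rightarrow> filling set" where
  "min_overlap_patterns n k = {P \<in> column_strict_arrays n k. minimally_overlapping k P}"

definition min_overlap_ratio :: "nat \<Rightarrow> nat \<Rightarrow> real" where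
  "min_overlap_ratio n k =
     real (card (min_overlap_patterns n k)) / real (card (column_strict_arrays n k))"

text \<open>Maximum packings are indexed by their number of columns \<open>N = m * (length P - 1) + 1\<close>;
  the number \<open>m\<close> of matches is recovered from \<open>N\<close> by the division below.\<close>

definition max_packings :: "nat \<Rightarrow> filling \<Rightarrow> nat \<Rightarrow> nat" where
  "max_packings k P N =
     card {F \<in> column_strict_arrays N k. mch P F = (N - 1) div (length P - 1)}"

lemma max_packings_eq:
  assumes "length P \<ge> 2"
  shows "max_packings k P (m * (length P - 1) + 1) =
    card {F \<in> column_strict_arrays (m * (length P - 1) + 1) k. mch P F = m}"
  using assms by (simp add: max_packings_def)

lemma max_packings_two:
  assumes "odd n" "n \<ge> 3" "P \<in> min_overlap_patterns ((n + 1) div 2) k"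
  shows "max_packings k P n = card {F \<in> column_strict_arrays n k. mch P F = 2}"
proof -
  have len: "length P = (n + 1) div 2"
    using assms(3) by (simp add: min_overlap_patterns_def column_strict_arrays_def)
  have "n = 2 * (length P - 1) + 1" "length P \<ge> 2"
    unfolding len using assms(1,2) by presburger+
  then show ?thesis
    using max_packings_eq[of P k 2] by simp
qed

lemma finite_column_strict_arrays: "finite (column_strict_arrays n k)"
proof (rule finite_subset)
  show "column_strict_arrays n k
      \<subseteq> {F. set F \<subseteq> {c. set c \<subseteq> {1..k * n} \<and> length c = k} \<and> length F = n}"
    by (fastforce simp: column_strict_arrays_def entries_def)
  show "finite {F. set F \<subseteq> {c. set c \<subseteq> {1..k * n} \<and> length c = k} \<and> length F = n}"
    by (intro finite_lists_length_eq) simp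
qed

end

theory Submission
  imports Defs
begin

text \<open>Say that \<open>P\<close> with \<open>n\<close> columns overlaps itself in \<open>b\<close> columns if its first \<open>b\<close> and its last \<open>b\<close>
  columns reduce to the same array. Two copies of \<open>P\<close> can then be glued along these columns, so \<open>P\<close> is
  minimally overlapping iff it has no self-overlap \<open>b\<close> with \<open>2 \<le> b < n\<close>. For every other \<open>P\<close>, the
  smallest such \<open>b\<close> is at most \<open>(n + 1) div 2\<close>, and the common reduction \<open>Q\<close> of both ends is minimally
  overlapping. If \<open>2 * b \<le> n\<close>, the two ends are disjoint and their reductions are independent and
  uniformly distributed, so \<open>Q\<close> occurs at both ends with probability \<open>1 / |F_{b,k}|\<^sup>2\<close>. If
  \<open>2 * b = n + 1\<close>, such \<open>P\<close> are the maximum packings for \<open>Q\<close> with two matches.\<close>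

section \<open>Relabelling and reduction\<close>

abbreviation relabel :: "(nat \<Rightarrow> nat) \<Rightarrow> filling \<Rightarrow> filling" where
  "relabel h F \<equiv> map (map h) F"

text \<open>The relabelling performed by \<open>red\<close>, detached from the filling so that it
  applies to parts of a filling and to any finite set.\<close>

definition rank :: "nat set \<Rightarrow> nat \<Rightarrow> nat" where
  "rank A x = card {y \<in> A. y \<le> x}"

text \<open>Blocks of consecutive columns of an array need not use an initial segment of the
  numbers, so the entry set is kept as a parameter.\<close>

definition fillings :: "nat \<Rightarrow> nat set \<Rightarrow> nat \<Rightarrow> filling set" where
  "fillings k A n =
     {F. length F = n \<and> (\<forall>c \<in> set F. length c = k \<and> sorted_wrt (<) c) \<and>
         distinct (concat F) \<and> entries F = A}"

lemma column_strict_arrays_eq_fillings: "column_strict_arrays n k = fillings k {1..k * n} n"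
  by (simp add: column_strict_arrays_def fillings_def)

lemma entries_append [simp]: "entries (F @ G) = entries F \<union> entries G"
  by (simp add: entries_def)

lemma entries_relabel [simp]: "entries (relabel h F) = h ` entries F"
  by (auto simp: entries_def)

lemma finite_entries [simp]: "finite (entries F)"
  by (simp add: entries_def)

lemma entries_take_subset: "entries (take i F) \<subseteq> entries F"
  by (auto simp: entries_def dest: in_set_takeD)

lemma entries_drop_subset: "entries (drop i F) \<subseteq> entries F"
  by (auto simp: entries_def dest: in_set_dropD)

lemma relabel_cong: "(\<And>x. x \<in> entries F \<Longrightarrow> g x = h x) \<Longrightarrow> relabel g F = relabel h F"
  by (auto simp: entries_def)

lemma red_eq_relabel_rank: "red F = relabel (rank (entries F)) F"
  by (simp add: red_def rank_def[abs_def])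

lemma length_red [simp]: "length (red F) = length F"
  by (simp add: red_def)

lemma strict_mono_on_rank:
  assumes "finite A"
  shows "strict_mono_on A (rank A)"
proof (rule strict_mono_onI)
  fix x y assume "x \<in> A" "y \<in> A" "x < y"
  then have "{z \<in> A. z \<le> x} \<subseteq> {z \<in> A. z \<le> y}"
    and "y \<in> {z \<in> A. z \<le> y}" "y \<notin> {z \<in> A. z \<le> x}" by auto
  then have "{z \<in> A. z \<le> x} \<subset> {z \<in> A. z \<le> y}" by blast
  then show "rank A x < rank A y"
    unfolding rank_def using assms by (intro psubset_card_mono) auto
qed

lemma rank_image:
  assumes "finite A"
  shows "rank A ` A = {1..card A}"
proof (rule card_subset_eq)
  show "rank A ` A \<subseteq> {1..card A}"
  proof
    fix r assume "r \<in> rank A ` A"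
    then obtain x where x: "x \<in> A" "r = card {y \<in> A. y \<le> x}" by (auto simp: rank_def)
    have "{y \<in> A. y \<le> x} \<noteq> {}" "finite {y \<in> A. y \<le> x}" using x assms by auto
    then have "r \<noteq> 0" using x by simp
    moreover have "r \<le> card A" using x assms by (auto intro!: card_mono)
    ultimately show "r \<in> {1..card A}" by simp
  qed
  show "card (rank A ` A) = card {1..card A}"
    using strict_mono_on_imp_inj_on[OF strict_mono_on_rank[OF assms]] by (simp add: card_image)
qed simp

lemma rank_relabel:
  assumes "strict_mono_on A h" "x \<in> A"
  shows "rank (h ` A) (h x) = rank A x"
proof -
  have "{y \<in> h ` A. y \<le> h x} = h ` {y \<in> A. y \<le> x}"
    using assms by (auto simp: strict_mono_on_less_eq)
  moreover have "inj_on h {y \<in> A. y \<le> x}"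
    using strict_mono_on_imp_inj_on[OF assms(1)] by (rule inj_on_subset) auto
  ultimately show ?thesis by (simp add: rank_def card_image)
qed

lemma red_relabel:
  assumes "strict_mono_on (entries F) h"
  shows "red (relabel h F) = red F"
proof -
  have "relabel (rank (h ` entries F) \<circ> h) F = relabel (rank (entries F)) F"
    by (rule relabel_cong) (simp add: rank_relabel[OF assms])
  then show ?thesis by (simp add: red_eq_relabel_rank)
qed

lemma entries_red: "entries (red F) = {1..card (entries F)}"
  by (simp add: red_eq_relabel_rank rank_image)

lemma strict_mono_on_inv_rank:
  assumes "finite A"
  shows "strict_mono_on {1..card A} (inv_into A (rank A))"
proof (rule strict_mono_onI)
  fix r s assume r: "r \<in> {1..card A}" and s: "s \<in> {1..card A}" and "r < s"
  have "inv_into A (rank A) r \<in> A" "inv_into A (rank A) s \<in> A"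
    and "rank A (inv_into A (rank A) r) = r" "rank A (inv_into A (rank A) s) = s"
    using r s rank_image[OF assms] by (metis inv_into_into, metis inv_into_into,
        metis f_inv_into_f, metis f_inv_into_f)
  then show "inv_into A (rank A) r < inv_into A (rank A) s"
    using \<open>r < s\<close> strict_mono_on_less[OF strict_mono_on_rank[OF assms]] by metis
qed

text \<open>Converse of \<open>red_relabel\<close>: each entry of \<open>F\<close> is sent to its
  rank and then to the entry of \<open>G\<close> with that rank.\<close>

lemma red_eq_imp_relabel:
  assumes "red F = red G"
  obtains h where "strict_mono_on (entries F) h" "G = relabel h F"
proof -
  let ?A = "entries F" and ?B = "entries G"
  define i where "i = inv_into ?B (rank ?B)"
  have c: "card ?A = card ?B" using assms entries_red[of F] entries_red[of G]
    by (metis card_atLeastAtMost diff_Suc_1)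
  have "strict_mono_on ?A (i \<circ> rank ?A)"
  proof (rule strict_mono_onI)
    fix x y assume "x \<in> ?A" "y \<in> ?A" "x < y"
    moreover have "strict_mono_on {1..card ?A} i"
      unfolding i_def c by (rule strict_mono_on_inv_rank) simp
    moreover have "rank ?A x \<in> {1..card ?A}" "rank ?A y \<in> {1..card ?A}"
      using \<open>x \<in> ?A\<close> \<open>y \<in> ?A\<close> rank_image[of ?A] by auto
    ultimately show "(i \<circ> rank ?A) x < (i \<circ> rank ?A) y"
      using strict_mono_on_rank[of ?A] by (simp add: strict_mono_onD)
  qed
  moreover have "G = relabel (i \<circ> rank ?A) F"
  proof -
    have "relabel (i \<circ> rank ?B) G = relabel id G"
      by (rule relabel_cong)
        (simp add: i_def inv_into_f_f strict_mono_on_imp_inj_on[OF strict_mono_on_rank])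
    then have "G = relabel i (red G)" by (simp add: red_eq_relabel_rank)
    also have "\<dots> = relabel i (red F)" using assms by simp
    finally show ?thesis by (simp add: red_eq_relabel_rank)
  qed
  ultimately show thesis by (rule that)
qed

text \<open>Ranking within all of \<open>F\<close> is increasing on the entries of any part, so a
  block of columns has the same reduction before and after \<open>F\<close> is reduced.\<close>

lemma red_relabel_rank_sub:
  assumes "entries S \<subseteq> entries F"
  shows "red (relabel (rank (entries F)) S) = red S"
  using red_relabel monotone_on_subset[OF strict_mono_on_rank assms] by simp

lemma red_take_red [simp]: "red (take i (red F)) = red (take i F)"
  unfolding red_eq_relabel_rank[of F] take_map
  by (rule red_relabel_rank_sub[OF entries_take_subset])

lemma red_drop_red [simp]: "red (drop i (red F)) = red (drop i F)"
  unfolding red_eq_relabel_rank[of F] drop_map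
  by (rule red_relabel_rank_sub[OF entries_drop_subset])

lemma red_take_drop_red [simp]: "red (take j (drop i (red F))) = red (take j (drop i F))"
proof -
  have "entries (take j (drop i F)) \<subseteq> entries F"
    using entries_take_subset entries_drop_subset by blast
  then show ?thesis
    unfolding red_eq_relabel_rank[of F] drop_map take_map by (rule red_relabel_rank_sub)
qed

section \<open>Fillings with a prescribed set of entries\<close>

lemma card_entries_fillings:
  assumes "F \<in> fillings k A n"
  shows "card A = k * n"
proof -
  have "card A = length (concat F)"
    using assms distinct_card[of "concat F"] by (auto simp: fillings_def entries_def)
  also have "\<dots> = sum_list (map (\<lambda>c. k) F)"
    unfolding length_concat using assms by (intro arg_cong[where f = sum_list]) (auto simp: fillings_def)
  also have "\<dots> = k * n" using assms by (simp add: fillings_def sum_list_triv)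
  finally show ?thesis .
qed

lemma relabel_in_fillings:
  assumes F: "F \<in> fillings k A n" and h: "strict_mono_on A h"
  shows "relabel h F \<in> fillings k (h ` A) n"
proof -
  have A: "set (concat F) = A" using F by (simp add: fillings_def entries_def)
  have "distinct (concat (relabel h F))"
    unfolding map_concat[symmetric] distinct_map
    using F strict_mono_on_imp_inj_on[OF h] A by (simp add: fillings_def)
  moreover have "sorted_wrt (<) (map h c)" if "c \<in> set F" for c
  proof -
    have "sorted_wrt (<) c" "set c \<subseteq> A" using that F A by (auto simp: fillings_def)
    then show ?thesis unfolding sorted_wrt_map
      using h by (auto elim!: sorted_wrt_mono_rel[rotated] intro: strict_mono_onD)
  qed
  ultimately show ?thesis using F by (auto simp: fillings_def)
qed

lemma red_in_column_strict_arrays: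
  assumes "F \<in> fillings k A n"
  shows "red F \<in> column_strict_arrays n k"
proof -
  have A: "entries F = A" "finite A" using assms finite_entries[of F] by (auto simp: fillings_def)
  have "relabel (rank A) F \<in> fillings k (rank A ` A) n"
    using assms by (rule relabel_in_fillings) (rule strict_mono_on_rank[OF A(2)])
  then show ?thesis
    using A rank_image card_entries_fillings[OF assms]
    by (simp add: red_eq_relabel_rank column_strict_arrays_eq_fillings)
qed

lemma take_in_fillings:
  assumes "F \<in> fillings k A n" "i \<le> n"
  shows "take i F \<in> fillings k (entries (take i F)) i"
proof -
  have "concat F = concat (take i F) @ concat (drop i F)"
    by (metis append_take_drop_id concat_append)
  then show ?thesis using assms by (auto simp: fillings_def dest: in_set_takeD)
qed

lemma drop_in_fillings:
  assumes "F \<in> fillings k A n"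
  shows "drop i F \<in> fillings k (entries (drop i F)) (n - i)"
proof -
  have "concat F = concat (take i F) @ concat (drop i F)"
    by (metis append_take_drop_id concat_append)
  then show ?thesis using assms by (auto simp: fillings_def dest: in_set_dropD)
qed

lemma append_in_fillings:
  assumes "F \<in> fillings k A n" "G \<in> fillings k B m" "A \<inter> B = {}"
  shows "F @ G \<in> fillings k (A \<union> B) (n + m)"
  using assms by (auto simp: fillings_def entries_def)

lemma red_column_strict_array:
  assumes "P \<in> column_strict_arrays n k"
  shows "red P = P"
proof -
  have A: "entries P = {1..k * n}" using assms by (simp add: column_strict_arrays_def)
  have "relabel (rank (entries P)) P = relabel id P"
  proof (rule relabel_cong)
    fix x assume "x \<in> entries P"
    then have "{y \<in> entries P. y \<le> x} = {1..x}" using A by auto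
    then show "rank (entries P) x = id x" by (simp add: rank_def)
  qed
  then show ?thesis by (simp add: red_eq_relabel_rank)
qed

text \<open>The inverse relabels by the order isomorphism from \<open>{1..k * n}\<close> onto
  \<open>A\<close>. Hence a block with known entry set is determined by its reduction, which may be
  prescribed freely.\<close>

lemma bij_betw_red:
  assumes "finite A" "card A = k * n"
  shows "bij_betw red (fillings k A n) (column_strict_arrays n k)"
proof (rule bij_betw_imageI)
  show "inj_on red (fillings k A n)"
  proof (rule inj_onI)
    fix F G assume F: "F \<in> fillings k A n" and G: "G \<in> fillings k A n" and eq: "red F = red G"
    have id: "H = relabel (inv_into A (rank A)) (red H)" if "H \<in> fillings k A n" for H
    proof -
      have "relabel (inv_into A (rank A) \<circ> rank A) H = relabel id H"
        using that assms strict_mono_on_imp_inj_on[OF strict_mono_on_rank]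
        by (intro relabel_cong) (auto simp: fillings_def)
      then show ?thesis using that by (simp add: red_eq_relabel_rank fillings_def)
    qed
    show "F = G" using id[OF F] id[OF G] eq by simp
  qed
  show "red ` fillings k A n = column_strict_arrays n k"
  proof
    show "red ` fillings k A n \<subseteq> column_strict_arrays n k"
      using red_in_column_strict_arrays by blast
    show "column_strict_arrays n k \<subseteq> red ` fillings k A n"
    proof
      fix P assume P: "P \<in> column_strict_arrays n k"
      let ?h = "inv_into A (rank A)"
      have h: "strict_mono_on {1..k * n} ?h"
        using strict_mono_on_inv_rank[OF assms(1)] assms(2) by simp
      have "?h ` {1..k * n} = A"
        using rank_image[OF assms(1)] strict_mono_on_imp_inj_on[OF strict_mono_on_rank[OF assms(1)]]
          assms(2) by (metis inj_on_imp_bij_betw bij_betw_inv_into bij_betw_imp_surj_on)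
      then have "relabel ?h P \<in> fillings k A n"
        using relabel_in_fillings[of P k "{1..k * n}" n ?h] P h
        by (simp add: column_strict_arrays_eq_fillings)
      moreover have "red (relabel ?h P) = P"
        using red_relabel[of P ?h] red_column_strict_array[OF P] P h
        by (simp add: column_strict_arrays_def)
      ultimately show "P \<in> red ` fillings k A n" by (metis imageI)
    qed
  qed
qed

section \<open>Matches and self-overlaps\<close>

text \<open>Columns are numbered from 1 but \<open>drop\<close> counts from 0, hence the successor;
  position 0 never carries a match.\<close>

lemma match_at_Suc_iff:
  "match_at P F (Suc p) \<longleftrightarrow>
     p + length P \<le> length F \<and> red (take (length P) (drop p F)) = P"
proof -
  have "select_columns F [Suc p..<Suc p + length P] = take (length P) (drop p F)"
    if "p + length P \<le> length F"
    using that by (intro nth_equalityI) (simp_all add: select_columns_def del: upt_Suc)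
  then show ?thesis by (auto simp: match_at_def)
qed

text \<open>Lets an array be built with convenient large entries and reduced only at the
  end.\<close>

lemma match_at_red [simp]: "match_at P (red F) i \<longleftrightarrow> match_at P F i"
proof (cases i)
  case (Suc p)
  then show ?thesis by (simp add: match_at_Suc_iff)
qed (simp add: match_at_def)

text \<open>For \<open>b \<ge> length P\<close> both sides are \<open>red P\<close>, so only widths
  below \<open>length P\<close> carry information.\<close>

definition self_overlap :: "filling \<Rightarrow> nat \<Rightarrow> bool" where
  "self_overlap P b \<longleftrightarrow> red (take b P) = red (drop (length P - b) P)"

text \<open>The columns common to the two copies are the last ones of the left copy and the first
  ones of the right copy.\<close>

lemma self_overlap_matches:
  assumes "match_at P F (Suc p)" "match_at P F (Suc q)" "p \<le> q" "q - p \<le> length P"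
  shows "self_overlap P (length P - (q - p))"
proof -
  let ?j = "length P" and ?d = "q - p"
  have P: "red (take ?j (drop p F)) = P" "red (take ?j (drop q F)) = P"
    using assms by (auto simp: match_at_Suc_iff)
  have "red (drop ?d P) = red (drop ?d (take ?j (drop p F)))"
    using red_drop_red[of ?d "take ?j (drop p F)"] P(1) by simp
  also have "drop ?d (take ?j (drop p F)) = take (?j - ?d) (take ?j (drop q F))"
    using assms(3) by (simp add: drop_take)
  also have "red \<dots> = red (take (?j - ?d) P)"
    using red_take_red[of "?j - ?d" "take ?j (drop q F)"] P(2) by simp
  finally show ?thesis using assms(4) by (simp add: self_overlap_def)
qed

lemma column_strict_arrays_one:
  assumes P: "P \<in> column_strict_arrays 1 k"
  shows "P = [[1..<Suc k]]"
proof -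
  obtain c where c: "P = [c]"
    using P by (auto simp: column_strict_arrays_def length_Suc_conv)
  have "sorted_wrt (<) c" "set c = {1..k}"
    using P unfolding c by (simp_all add: column_strict_arrays_def entries_def)
  moreover have "sorted_wrt (<) [1..<Suc k]" "set [1..<Suc k] = {1..k}"
    by (auto simp del: upt_Suc)
  ultimately have "c = [1..<Suc k]"
    using strict_sorted_equal by metis
  then show ?thesis using c by simp
qed

text \<open>All single columns reduce to the same column. Two copies can therefore always be glued
  along one column, which gives the width \<open>2 * n - 1\<close>.\<close>

lemma self_overlap_one:
  assumes "P \<in> column_strict_arrays n k" "n \<ge> 1"
  shows "self_overlap P 1"
proof -
  note P = assms(1)[unfolded column_strict_arrays_eq_fillings]
  have "length P = n" using P by (simp add: fillings_def)
  moreover have "red (take 1 P) \<in> column_strict_arrays 1 k"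
    using take_in_fillings[OF P assms(2)] by (rule red_in_column_strict_arrays)
  moreover have "red (drop (n - 1) P) \<in> column_strict_arrays 1 k"
    using red_in_column_strict_arrays[OF drop_in_fillings[OF P, of "n - 1"]] assms(2) by simp
  ultimately show ?thesis unfolding self_overlap_def
    by (metis column_strict_arrays_one)
qed

text \<open>Two copies of \<open>P\<close> are superposed along the overlap. Scaling the first copy by \<open>N\<close>, larger
  than all entries, leaves room between its entries: an entry \<open>x\<close> of the second copy outside the
  overlap is put \<open>x\<close> above the image of the largest overlap entry below \<open>x\<close>.\<close>

lemma strict_mono_extension:
  fixes h :: "nat \<Rightarrow> nat"
  assumes S: "finite S" "strict_mono_on S h" and N: "\<And>x. x \<in> A \<Longrightarrow> 0 < x \<and> x < N"
    and "\<And>x. x \<in> S \<Longrightarrow> 0 < h x"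
  obtains g where "strict_mono_on A g" "\<And>x. x \<in> S \<Longrightarrow> g x = N * h x"
    "\<And>x. x \<in> A - S \<Longrightarrow> \<not> N dvd g x"
proof -
  \<comment> \<open>The inserted 0 is the value for an \<open>x\<close> below all of
    \<open>S\<close>; positivity of \<open>h\<close> on \<open>S\<close> keeps it under every
    image.\<close>
  define m where "m x = Max (insert 0 (h ` {s \<in> S. s \<le> x}))" for x
  define g where "g x = N * m x + (if x \<in> S then 0 else x)" for x
  have m_S: "m x = h x" if "x \<in> S" for x
    unfolding m_def using that S
    by (intro Max_eqI) (auto simp: strict_mono_on_less_eq)
  have m_mono: "m x \<le> m y" if "x \<le> y" for x y
    unfolding m_def using that S by (intro Max_mono) auto
  have m_less: "m x < h y" if "x < y" "y \<in> S" for x y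
    unfolding m_def using that S assms(4)
    by (subst Max_less_iff) (auto simp: strict_mono_on_less)
  have "strict_mono_on A g"
  proof (rule strict_mono_onI)
    fix x y assume xy: "x \<in> A" "y \<in> A" "x < y"
    show "g x < g y"
    proof (cases "y \<in> S")
      case True
      \<comment> \<open>The offset is at most \<open>x < N\<close>, so it does not reach the next
        multiple of \<open>N\<close>.\<close>
      have "g x < N * Suc (m x)" using N[OF xy(1)] by (auto simp: g_def)
      also have "\<dots> \<le> N * m y" using m_less[OF xy(3) True] m_S[OF True] by (intro mult_le_mono2) simp
      finally show ?thesis using True by (simp add: g_def)
    next
      case False
      have "N * m x \<le> N * m y" using m_mono[of x y] xy(3) by simp
      then have "N * m x < N * m y + y" "N * m x + x < N * m y + y"
        using xy(3) by linarith+
      then show ?thesis using False by (simp add: g_def)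
    qed
  qed
  moreover have "g x = N * h x" if "x \<in> S" for x using that m_S by (simp add: g_def)
  moreover have "\<not> N dvd g x" if "x \<in> A - S" for x
    using that N[of x] nat_dvd_not_less[of x N]
    by (simp add: g_def dvd_add_right_iff)
  ultimately show thesis by (rule that)
qed

lemma superpose:
  assumes P: "P \<in> column_strict_arrays n k" and b: "b \<le> n" and ov: "self_overlap P b"
  obtains F where "F \<in> column_strict_arrays (2 * n - b) k"
    "match_at P F (Suc 0)" "match_at P F (Suc (n - b))"
proof -
  note P' = P[unfolded column_strict_arrays_eq_fillings]
  have len: "length P = n" and ent: "entries P = {1..k * n}"
    using P' by (auto simp: fillings_def)
  define N where "N = Suc (k * n)"
  let ?S = "entries (take b P)"
  have "red (take b P) = red (drop (n - b) P)" using ov len by (simp add: self_overlap_def)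
  then obtain h where h: "strict_mono_on ?S h" and drop_P: "drop (n - b) P = relabel h (take b P)"
    by (rule red_eq_imp_relabel)
  have "h ` ?S \<subseteq> entries P"
    using drop_P entries_drop_subset[of "n - b" P] by (metis entries_relabel)
  then have h_pos: "0 < h x" if "x \<in> ?S" for x using that ent by fastforce
  obtain g where g: "strict_mono_on (entries P) g" and g_S: "\<And>x. x \<in> ?S \<Longrightarrow> g x = N * h x"
    and g_not: "\<And>x. x \<in> entries P - ?S \<Longrightarrow> \<not> N dvd g x"
    by (rule strict_mono_extension[OF finite_entries h, where A = "entries P" and N = N])
      (use ent h_pos in \<open>auto simp: N_def\<close>)
  let ?s = "\<lambda>x. N * x"
  \<comment> \<open>The scaled first copy, followed by the columns of the second copy outside the
    overlap.\<close>
  define G where "G = relabel ?s P @ relabel g (drop b P)"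
  have "N > 0" by (simp add: N_def)
  then have s: "strict_mono_on (entries P) ?s" by (intro strict_mono_onI) simp
  have disj: "?S \<inter> entries (drop b P) = {}"
  proof -
    have "concat P = concat (take b P) @ concat (drop b P)"
      by (metis append_take_drop_id concat_append)
    then show ?thesis using P' by (auto simp: entries_def fillings_def)
  qed
  have "relabel ?s P \<in> fillings k (?s ` entries P) n"
    using relabel_in_fillings[OF P', of ?s] s ent by simp
  moreover have "relabel g (drop b P) \<in> fillings k (g ` entries (drop b P)) (n - b)"
    using drop_in_fillings[OF P'] monotone_on_subset[OF g entries_drop_subset]
    by (rule relabel_in_fillings)
  \<comment> \<open>Entries of the first copy are multiples of \<open>N\<close>, the added ones are
    not.\<close>
  moreover have "?s ` entries P \<inter> g ` entries (drop b P) = {}"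
  proof -
    have "\<not> N dvd g x" if "x \<in> entries (drop b P)" for x
      using that disj entries_drop_subset g_not by blast
    then have "N * y \<noteq> g x" if "x \<in> entries (drop b P)" for x y
      using that by (metis dvd_triv_left)
    then show ?thesis by blast
  qed
  ultimately have "G \<in> fillings k (?s ` entries P \<union> g ` entries (drop b P)) (n + (n - b))"
    unfolding G_def by (rule append_in_fillings)
  then have G: "red G \<in> column_strict_arrays (2 * n - b) k"
    using red_in_column_strict_arrays b by (metis add_diff_assoc mult_2)
  have "take n G = relabel ?s P" using len by (simp add: G_def)
  then have "red (take n G) = P"
    using red_relabel[OF s] red_column_strict_array[OF P] by simp
  then have m1: "match_at P (red G) (Suc 0)"
    using len by (simp add: match_at_Suc_iff G_def)
  \<comment> \<open>On the first \<open>b\<close> columns of \<open>P\<close> the map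
    \<open>g\<close> is \<open>h\<close> followed by scaling, so the last \<open>n\<close> columns
    of \<open>G\<close> are exactly \<open>relabel g P\<close>.\<close>
  have "drop (n - b) G = relabel ?s (drop (n - b) P) @ relabel g (drop b P)"
    using len by (simp add: G_def drop_map)
  also have "relabel ?s (drop (n - b) P) = relabel (?s \<circ> h) (take b P)"
    by (simp add: drop_P)
  also have "\<dots> = relabel g (take b P)" by (rule relabel_cong) (simp add: g_S)
  also have "\<dots> @ relabel g (drop b P) = relabel g P" by (metis append_take_drop_id map_append)
  finally have "red (drop (n - b) G) = P"
    using red_relabel[OF g] red_column_strict_array[OF P] by simp
  moreover have "length (drop (n - b) G) = n" using len b by (simp add: G_def)
  ultimately have "match_at P (red G) (Suc (n - b))"
    using len b by (simp add: match_at_Suc_iff G_def)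
  with G m1 show thesis by (rule that)
qed

section \<open>Characterisation of minimally overlapping patterns\<close>

lemma match_positions:
  assumes "match_at P F i" "match_at P F j" "i < j" "j - i < length P"
  shows "self_overlap P (length P - (j - i))"
proof -
  have "i = Suc (i - 1)" "j = Suc (j - 1)" using assms(1,3) by (auto simp: match_at_def)
  then show ?thesis using self_overlap_matches[of P F "i - 1" "j - 1"] assms by simp
qed

text \<open>In the superposition along \<open>b\<close> columns, a third match would start strictly
  between the two given ones and meet the first copy in more than \<open>b\<close> but fewer than
  \<open>n\<close> columns, against maximality.\<close>

lemma superpose_two_matches:
  assumes P: "P \<in> column_strict_arrays n k" and b: "1 \<le> b" "b < n" and ov: "self_overlap P b"
    and maximal: "\<And>c. b < c \<Longrightarrow> c < n \<Longrightarrow> \<not> self_overlap P c"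
  shows "\<exists>F \<in> column_strict_arrays (2 * n - b) k. mch P F = 2"
proof -
  have len: "length P = n" using P by (simp add: column_strict_arrays_def)
  obtain F where F: "F \<in> column_strict_arrays (2 * n - b) k"
    "match_at P F (Suc 0)" "match_at P F (Suc (n - b))"
    using superpose[OF P _ ov] b by auto
  have "i \<in> {Suc 0, Suc (n - b)}" if i: "match_at P F i" for i
  proof (rule ccontr)
    assume *: "i \<notin> {Suc 0, Suc (n - b)}"
    have "1 \<le> i" "i + n - 1 \<le> 2 * n - b"
      using i F(1) len by (auto simp: match_at_def column_strict_arrays_def)
    with * b have i': "Suc 0 < i" "i < Suc (n - b)" by auto
    then have "self_overlap P (n - (i - Suc 0))"
      using match_positions[OF F(2) i] len by simp
    moreover have "b < n - (i - Suc 0)" "n - (i - Suc 0) < n" using i' b by auto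
    ultimately show False using maximal by blast
  qed
  then have "{i. match_at P F i} = {Suc 0, Suc (n - b)}" using F by auto
  then have "mch P F = 2" using b by (simp add: mch_def)
  then show ?thesis using F(1) by blast
qed

lemma two_matches_obtain:
  assumes "mch P F = 2"
  obtains i j where "match_at P F i" "match_at P F j" "i < j"
proof -
  obtain i j where ij: "{i. match_at P F i} = {i, j}" "i \<noteq> j"
    using assms unfolding mch_def card_2_iff by auto
  have m: "match_at P F i" "match_at P F j" using ij(1) by blast+
  show thesis
  proof (cases "i < j")
    case True
    then show thesis using that m by blast
  next
    case False
    then have "j < i" using ij(2) by simp
    then show thesis using that m by blast
  qed
qed

text \<open>A self-overlap in at least two columns yields, by superposition, a shorter array with
  two matches. Without one, two matches are at least \<open>n - 1\<close> positions apart, which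
  forces \<open>2 * n - 1\<close> columns, and gluing along one column attains this.\<close>

lemma minimally_overlapping_iff:
  assumes P: "P \<in> column_strict_arrays n k" and n: "n \<ge> 2"
  shows "minimally_overlapping k P \<longleftrightarrow> (\<forall>b. 2 \<le> b \<longrightarrow> b < n \<longrightarrow> \<not> self_overlap P b)"
proof -
  have len: "length P = n" using P by (simp add: column_strict_arrays_def)
  show ?thesis
  proof
    assume mo: "minimally_overlapping k P"
    show "\<forall>b. 2 \<le> b \<longrightarrow> b < n \<longrightarrow> \<not> self_overlap P b"
    proof (rule ccontr)
      assume "\<not> ?thesis"
      then have ne: "{b. 2 \<le> b \<and> b < n \<and> self_overlap P b} \<noteq> {}" (is "?B \<noteq> {}") by auto
      have fin: "finite ?B" by simp
      \<comment> \<open>The widest overlap is taken so that the superposition has exactly two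
        matches, as \<open>mch P F = 2\<close> demands.\<close>
      define b where "b = Max ?B"
      have "b \<in> ?B" unfolding b_def using fin ne by (rule Max_in)
      moreover have "\<not> self_overlap P c" if "b < c" "c < n" for c
      proof
        assume "self_overlap P c"
        then have "c \<in> ?B" using that \<open>b \<in> ?B\<close> by simp
        then show False using Max_ge[OF fin] that(1) unfolding b_def by fastforce
      qed
      ultimately obtain F where "F \<in> column_strict_arrays (2 * n - b) k" "mch P F = 2"
        using superpose_two_matches[OF P, of b] by auto
      moreover have "2 * n - b \<ge> 1" using \<open>b \<in> ?B\<close> by (simp, linarith)
      ultimately have "2 * n - 1 \<le> 2 * n - b"
        using mo len unfolding minimally_overlapping_def by blast
      then show False using \<open>b \<in> ?B\<close> by auto
    qed
  next
    assume no: "\<forall>b. 2 \<le> b \<longrightarrow> b < n \<longrightarrow> \<not> self_overlap P b"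
    have "2 * n - 1 \<le> i" if F: "F \<in> column_strict_arrays i k" "mch P F = 2" for i F
    proof -
      obtain p q where m: "match_at P F p" "match_at P F q" "p < q"
        using F(2) by (rule two_matches_obtain)
      have "n - 1 \<le> q - p"
      proof (rule ccontr)
        assume "\<not> ?thesis"
        then have "self_overlap P (n - (q - p))" "2 \<le> n - (q - p)" "n - (q - p) < n"
          using match_positions[OF m] len m(3) n by auto
        then show False using no by blast
      qed
      moreover have "1 \<le> p" "q + n - 1 \<le> i"
        using m(1,2) F(1) len by (auto simp: match_at_def column_strict_arrays_def)
      ultimately show ?thesis using m(3) by linarith
    qed
    moreover have "\<exists>F \<in> column_strict_arrays (2 * n - 1) k. mch P F = 2"
      using superpose_two_matches[OF P, of 1] self_overlap_one[OF P] n no by auto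
    ultimately show "minimally_overlapping k P"
      unfolding minimally_overlapping_def len by blast
  qed
qed

lemma min_overlap_patterns_iff:
  assumes "n \<ge> 2"
  shows "P \<in> min_overlap_patterns n k \<longleftrightarrow>
    P \<in> column_strict_arrays n k \<and> (\<forall>b. 2 \<le> b \<longrightarrow> b < n \<longrightarrow> \<not> self_overlap P b)"
  using minimally_overlapping_iff[OF _ assms] by (auto simp: min_overlap_patterns_def)

section \<open>Counting\<close>

lemma finite_fillings:
  assumes "finite A" "card A = k * n"
  shows "finite (fillings k A n)"
  using bij_betw_finite[OF bij_betw_red[OF assms]] finite_column_strict_arrays by blast

text \<open>The first column is determined by its entry set \<open>C\<close>, and the other columns
  fill the remaining entries arbitrarily.\<close>

lemma fillings_Suc:
  assumes "finite A"
  shows "fillings k A (Suc n) =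
    (\<Union>C \<in> {C. C \<subseteq> A \<and> card C = k}. (#) (sorted_list_of_set C) ` fillings k (A - C) n)"
proof (intro equalityI subsetI)
  fix F assume F: "F \<in> fillings k A (Suc n)"
  then obtain c G where FG: "F = c # G" by (auto simp: fillings_def length_Suc_conv)
  have c: "sorted_wrt (<) c" "length c = k" "set c \<subseteq> A"
    and G: "G \<in> fillings k (A - set c) n"
    using F unfolding FG by (auto simp: fillings_def entries_def)
  have "c = sorted_list_of_set (set c)"
    using c(1) by (simp add: sorted_list_of_set.idem_if_sorted_distinct strict_sorted_iff)
  moreover have "card (set c) = k"
    using c(1,2) by (simp add: strict_sorted_iff distinct_card)
  ultimately show "F \<in> (\<Union>C \<in> {C. C \<subseteq> A \<and> card C = k}.
      (#) (sorted_list_of_set C) ` fillings k (A - C) n)"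
    using c(3) G unfolding FG by blast
next
  fix F assume "F \<in> (\<Union>C \<in> {C. C \<subseteq> A \<and> card C = k}.
      (#) (sorted_list_of_set C) ` fillings k (A - C) n)"
  then obtain C G where C: "C \<subseteq> A" "card C = k" and F: "F = sorted_list_of_set C # G"
    and G: "G \<in> fillings k (A - C) n" by blast
  have "finite C" using C(1) assms by (rule finite_subset)
  then show "F \<in> fillings k A (Suc n)"
    using C G unfolding F by (auto simp: fillings_def entries_def)
qed

text \<open>The multinomial coefficient, in product form to avoid division in the naturals. Each
  induction step contributes the binomial choice of the entry set of the first column.\<close>

lemma card_fillings:
  assumes "finite A" "card A = k * n"
  shows "card (fillings k A n) * fact k ^ n = fact (k * n)"
  using assms
proof (induction n arbitrary: A)
  case 0
  then have "fillings k A 0 = {[]}" by (auto simp: fillings_def entries_def)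
  then show ?case by simp
next
  case (Suc n)
  let ?D = "{C. C \<subseteq> A \<and> card C = k}"
  let ?f = "\<lambda>C. (#) (sorted_list_of_set C) ` fillings k (A - C) n"
  have D: "finite C" "finite (A - C)" "card (A - C) = k * n" if "C \<in> ?D" for C
  proof -
    show "finite C" using that Suc.prems(1) by (auto intro: finite_subset)
    then show "card (A - C) = k * n" using that Suc.prems by (simp add: card_Diff_subset)
    show "finite (A - C)" using Suc.prems(1) by simp
  qed
  have "card (fillings k A (Suc n)) = (\<Sum>C\<in>?D. card (?f C))"
    unfolding fillings_Suc[OF Suc.prems(1)]
  proof (rule card_UN_disjoint)
    show "finite ?D" using Suc.prems(1) by simp
    show "\<forall>C\<in>?D. finite (?f C)" by (intro ballI finite_imageI finite_fillings D)
    show "\<forall>C\<in>?D. \<forall>C'\<in>?D. C \<noteq> C' \<longrightarrow> ?f C \<inter> ?f C' = {}"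
    proof (intro ballI impI)
      fix C C' assume "C \<in> ?D" "C' \<in> ?D" "C \<noteq> C'"
      then have "sorted_list_of_set C \<noteq> sorted_list_of_set C'"
        using D(1) sorted_list_of_set_inject by metis
      then show "?f C \<inter> ?f C' = {}" by blast
    qed
  qed
  also have "\<dots> = (\<Sum>C\<in>?D. card (fillings k (A - C) n))"
    by (simp add: card_image)
  finally have "card (fillings k A (Suc n)) * fact k ^ n
      = (\<Sum>C\<in>?D. card (fillings k (A - C) n) * fact k ^ n)"
    by (simp add: sum_distrib_right)
  also have "\<dots> = (\<Sum>C\<in>?D. fact (k * n))"
    by (intro sum.cong refl Suc.IH D)
  also have "\<dots> = (k * Suc n choose k) * fact (k * n)"
    using n_subsets[OF Suc.prems(1), of k] Suc.prems(2) by simp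
  finally have "card (fillings k A (Suc n)) * fact k ^ Suc n
      = fact k * fact (k * Suc n - k) * (k * Suc n choose k)"
    by (simp add: algebra_simps)
  also have "\<dots> = fact (k * Suc n)" by (rule binomial_fact_lemma) simp
  finally show ?case .
qed

lemma card_column_strict_arrays:
  "real (card (column_strict_arrays n k)) = fact (n * k) / fact k ^ n"
proof -
  have "card (column_strict_arrays n k) * fact k ^ n = fact (k * n)"
    unfolding column_strict_arrays_eq_fillings by (rule card_fillings) simp_all
  then have "real (card (column_strict_arrays n k) * fact k ^ n) = fact (n * k)"
    by (metis mult.commute of_nat_fact)
  then show ?thesis by (simp add: field_simps)
qed

section \<open>Joint distribution of the two end blocks\<close>

definition ends_with_patterns :: "nat \<Rightarrow> nat \<Rightarrow> nat \<Rightarrow> filling \<Rightarrow> filling \<Rightarrow> filling set" where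
  "ends_with_patterns k n i Q R =
     {P \<in> column_strict_arrays n k. red (take i P) = Q \<and> red (drop (n - i) P) = R}"

text \<open>Once the entry sets of the outer blocks are fixed, the three blocks can be chosen
  independently.\<close>

lemma append3_in_fillings_iff:
  assumes "length U = i" "length V = m" "length W = j"
  shows "U @ V @ W \<in> fillings k A (i + m + j) \<longleftrightarrow>
    U \<in> fillings k (entries U) i \<and> V \<in> fillings k (A - entries U - entries W) m \<and>
    W \<in> fillings k (entries W) j \<and> entries U \<subseteq> A \<and> entries W \<subseteq> A \<and> entries U \<inter> entries W = {}"
  using assms by (auto simp: fillings_def entries_def)

text \<open>Since \<open>2 * i \<le> n\<close>, the end blocks are disjoint. For given entry sets
  each has exactly one arrangement with the prescribed reduction, so the count does not depend on
  \<open>Q\<close> and \<open>R\<close>.\<close>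

lemma card_ends_with_patterns:
  fixes k n i :: nat
  assumes i: "2 * i \<le> n"
  obtains t where "\<And>Q R. Q \<in> column_strict_arrays i k \<Longrightarrow> R \<in> column_strict_arrays i k \<Longrightarrow>
    card (ends_with_patterns k n i Q R) = t"
proof -
  define m where "m = n - 2 * i"
  have n: "n = i + m + i" using i by (simp add: m_def)
  let ?A = "{1..k * n}"
  \<comment> \<open>What is left of an array when the arrangement inside its end blocks is
    forgotten: their entry sets \<open>A\<close> and \<open>B\<close>, and the middle block
    \<open>V\<close>. Neither \<open>Q\<close> nor \<open>R\<close> occurs here.\<close>
  define T where "T = {(A, V, B). A \<subseteq> ?A \<and> B \<subseteq> ?A \<and> A \<inter> B = {} \<and> card A = k * i \<and> card B = k * i \<and>
    V \<in> fillings k (?A - A - B) m}"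
  define f where "f P = (entries (take i P), take m (drop i P), entries (drop (i + m) P))" for P
  have "card (ends_with_patterns k n i Q R) = card T"
    if Q: "Q \<in> column_strict_arrays i k" and R: "R \<in> column_strict_arrays i k" for Q R
  proof (rule bij_betw_same_card, rule bij_betw_imageI)
    let ?E = "ends_with_patterns k n i Q R"
    have E: "\<exists>U V W. P = U @ V @ W \<and> length U = i \<and> length V = m \<and> length W = i \<and>
      U \<in> fillings k (entries U) i \<and> V \<in> fillings k (?A - entries U - entries W) m \<and>
      W \<in> fillings k (entries W) i \<and> entries U \<subseteq> ?A \<and> entries W \<subseteq> ?A \<and>
      entries U \<inter> entries W = {} \<and> red U = Q \<and> red W = R \<and> f P = (entries U, V, entries W)"
      if "P \<in> ?E" for P
    proof -
      define U V W where "U = take i P" and "V = take m (drop i P)" and "W = drop (i + m) P"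
      have P: "P \<in> fillings k ?A n" "red U = Q" "red W = R"
        using that n by (auto simp: ends_with_patterns_def column_strict_arrays_eq_fillings U_def W_def)
      have len: "length U = i" "length V = m" "length W = i"
        using P(1) n by (auto simp: fillings_def U_def V_def W_def)
      have "W = drop m (drop i P)" by (simp add: W_def add.commute)
      then have P_eq: "P = U @ V @ W" by (simp add: U_def V_def del: drop_drop)
      have "U @ V @ W \<in> fillings k ?A (i + m + i)"
        using P(1) unfolding P_eq[symmetric] n[symmetric] .
      moreover have "f P = (entries U, V, entries W)"
        by (simp add: f_def U_def V_def W_def)
      ultimately show ?thesis
        using append3_in_fillings_iff[OF len, of k ?A] P(2,3) P_eq len by blast
    qed
    show "inj_on f ?E"
    proof (rule inj_onI)
      fix P P' assume "P \<in> ?E" "P' \<in> ?E" and eq: "f P = f P'"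
      from E[OF \<open>P \<in> ?E\<close>] obtain U V W where P: "P = U @ V @ W"
        "U \<in> fillings k (entries U) i" "W \<in> fillings k (entries W) i" "red U = Q" "red W = R"
        "f P = (entries U, V, entries W)" by blast
      from E[OF \<open>P' \<in> ?E\<close>] obtain U' V' W' where P': "P' = U' @ V' @ W'"
        "U' \<in> fillings k (entries U') i" "W' \<in> fillings k (entries W') i" "red U' = Q" "red W' = R"
        "f P' = (entries U', V', entries W')" by blast
      have unique: "X = Y" if "X \<in> fillings k (entries X) i" "Y \<in> fillings k (entries Y) i"
        "entries X = entries Y" "red X = red Y" for X Y
        using bij_betw_red[OF finite_entries card_entries_fillings[OF that(1)]] that
        unfolding bij_betw_def by (metis inj_onD)
      have "U = U'" "V = V'" "W = W'" using unique P P' eq by auto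
      then show "P = P'" using P(1) P'(1) by simp
    qed
    show "f ` ?E = T"
    proof (intro equalityI subsetI)
      fix x assume "x \<in> f ` ?E"
      then obtain P where P: "P \<in> ?E" "x = f P" by blast
      from E[OF P(1)] show "x \<in> T"
        unfolding P(2) T_def using card_entries_fillings by fastforce
    next
      fix x assume "x \<in> T"
      then obtain A V B where x: "x = (A, V, B)" and A: "A \<subseteq> ?A" "card A = k * i"
        and B: "B \<subseteq> ?A" "card B = k * i" and AB: "A \<inter> B = {}"
        and V: "V \<in> fillings k (?A - A - B) m" by (auto simp: T_def)
      have fin: "finite A" "finite B" using A B finite_subset by blast+
      obtain U where U: "U \<in> fillings k A i" "red U = Q"
        using bij_betw_red[OF fin(1) A(2)] Q by (metis bij_betw_imp_surj_on imageE)
      obtain W where W: "W \<in> fillings k B i" "red W = R"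
        using bij_betw_red[OF fin(2) B(2)] R by (metis bij_betw_imp_surj_on imageE)
      have ent: "entries U = A" "entries W = B" and len: "length U = i" "length V = m" "length W = i"
        using U(1) V W(1) by (auto simp: fillings_def)
      have "U @ V @ W \<in> column_strict_arrays n k"
        using append3_in_fillings_iff[OF len, of k ?A] U W V A B AB ent n
        by (simp add: column_strict_arrays_eq_fillings)
      then have "U @ V @ W \<in> ?E"
        using len U W n by (simp add: ends_with_patterns_def)
      moreover have "f (U @ V @ W) = x" using len ent x by (simp add: f_def)
      ultimately show "x \<in> f ` ?E" by blast
    qed
  qed
  then show thesis by (rule that)
qed

text \<open>All pairs of end patterns are equally frequent, say \<open>t\<close> times each. With
  \<open>s\<close> patterns of width \<open>i\<close> there are \<open>s * s * t\<close> arrays, of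
  which \<open>card M * t\<close> have equal ends in \<open>M\<close>; the factor
  \<open>1 / s\<close> is the quotient of factorials.\<close>

lemma card_ends_with_same_pattern:
  assumes i: "2 * i \<le> n" and M: "M \<subseteq> column_strict_arrays i k"
  shows "real (card (\<Union>Q\<in>M. ends_with_patterns k n i Q Q)) / real (card (column_strict_arrays n k)) =
    real (card M) / real (card (column_strict_arrays i k)) * (fact k ^ i / fact (i * k))"
proof -
  let ?S = "column_strict_arrays i k"
  obtain t where t: "\<And>Q R. Q \<in> ?S \<Longrightarrow> R \<in> ?S \<Longrightarrow> card (ends_with_patterns k n i Q R) = t"
    using card_ends_with_patterns[OF i] by metis
  have "finite M" using M finite_column_strict_arrays by (rule finite_subset)
  then have "card (\<Union>Q\<in>M. ends_with_patterns k n i Q Q)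
      = (\<Sum>Q\<in>M. card (ends_with_patterns k n i Q Q))"
    by (intro card_UN_disjoint) (auto simp: ends_with_patterns_def finite_column_strict_arrays)
  also have "\<dots> = card M * t" using t M by (simp add: subset_iff)
  finally have 1: "card (\<Union>Q\<in>M. ends_with_patterns k n i Q Q) = card M * t" .
  have "column_strict_arrays n k = (\<Union>(Q, R)\<in>?S \<times> ?S. ends_with_patterns k n i Q R)"
  proof (intro equalityI subsetI)
    fix P assume P: "P \<in> column_strict_arrays n k"
    note P' = P[unfolded column_strict_arrays_eq_fillings]
    have "red (take i P) \<in> ?S" "red (drop (n - i) P) \<in> ?S"
      using red_in_column_strict_arrays[OF take_in_fillings[OF P', of i]]
        red_in_column_strict_arrays[OF drop_in_fillings[OF P', of "n - i"]] i by auto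
    then show "P \<in> (\<Union>(Q, R)\<in>?S \<times> ?S. ends_with_patterns k n i Q R)"
      using P by (auto simp: ends_with_patterns_def)
  qed (auto simp: ends_with_patterns_def)
  then have "card (column_strict_arrays n k)
      = card (\<Union>(Q, R)\<in>?S \<times> ?S. ends_with_patterns k n i Q R)" by simp
  also have "\<dots> = (\<Sum>(Q, R)\<in>?S \<times> ?S. card (ends_with_patterns k n i Q R))"
    unfolding split_def
    by (intro card_UN_disjoint) (auto simp: ends_with_patterns_def finite_column_strict_arrays)
  also have "\<dots> = (\<Sum>x\<in>?S \<times> ?S. t)" using t by (intro sum.cong) auto
  finally have 2: "card (column_strict_arrays n k) = card ?S * card ?S * t"
    by (simp add: card_cartesian_product)
  \<comment> \<open>Positivity of the total makes \<open>t\<close> and \<open>card ?S\<close>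
    nonzero, so that both can be cancelled.\<close>
  have pos: "real (card (column_strict_arrays n k)) > 0" by (simp add: card_column_strict_arrays)
  then have "card ?S * card ?S * t \<noteq> 0" using 2 by linarith
  then have "real t \<noteq> 0" "real (card ?S) \<noteq> 0" by auto
  then have "real (card (\<Union>Q\<in>M. ends_with_patterns k n i Q Q)) / real (card (column_strict_arrays n k))
      = real (card M) / real (card ?S) * (1 / real (card ?S))"
    by (simp add: 1 2)
  then show ?thesis by (simp add: card_column_strict_arrays)
qed

section \<open>Maximum packings and the partition by smallest self-overlap\<close>

lemma two_matches_iff:
  assumes Q: "Q \<in> min_overlap_patterns i k" and i: "i \<ge> 2"
    and F: "F \<in> column_strict_arrays (2 * i - 1) k"
  shows "mch Q F = 2 \<longleftrightarrow> F \<in> ends_with_patterns k (2 * i - 1) i Q Q"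
proof -
  have len: "length Q = i" "length F = 2 * i - 1"
    using Q F by (auto simp: min_overlap_patterns_def column_strict_arrays_def)
  \<comment> \<open>With \<open>2 * i - 1\<close> columns the end blocks start at positions 1 and
    \<open>i\<close> and share one column.\<close>
  have ends: "F \<in> ends_with_patterns k (2 * i - 1) i Q Q \<longleftrightarrow> match_at Q F 1 \<and> match_at Q F i"
    using match_at_Suc_iff[of Q F 0] match_at_Suc_iff[of Q F "i - 1"] i len F
    by (auto simp: ends_with_patterns_def)
  \<comment> \<open>Closer matches would give a self-overlap of \<open>Q\<close> in at least two
    columns. As all matches start in \<open>1..i\<close>, two of them can only be at 1 and
    \<open>i\<close>.\<close>
  have far: "i - 1 \<le> q - p" if "match_at Q F p" "match_at Q F q" "p < q" for p q
  proof (rule ccontr)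
    assume "\<not> ?thesis"
    then have "self_overlap Q (i - (q - p))" "2 \<le> i - (q - p)" "i - (q - p) < i"
      using match_positions[OF that] len that(3) i by auto
    then show False using Q min_overlap_patterns_iff[OF i] by blast
  qed
  have range: "1 \<le> p" "p \<le> i" if "match_at Q F p" for p
    using that len i by (auto simp: match_at_def)
  show ?thesis
  proof
    assume "mch Q F = 2"
    then obtain p q where m: "match_at Q F p" "match_at Q F q" "p < q"
      by (rule two_matches_obtain)
    then have "p = 1" "q = i" using far[OF m] range[OF m(1)] range[OF m(2)] by linarith+
    then show "F \<in> ends_with_patterns k (2 * i - 1) i Q Q" using m ends by simp
  next
    assume "F \<in> ends_with_patterns k (2 * i - 1) i Q Q"
    then have m: "match_at Q F 1" "match_at Q F i" using ends by auto
    have "p = 1 \<or> p = i" if "match_at Q F p" for p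
      using far[OF m(1) that] range[OF that] by linarith
    then have "{p. match_at Q F p} = {1, i}" using m by auto
    then show "mch Q F = 2" using i by (simp add: mch_def)
  qed
qed

text \<open>For \<open>2 \<le> i \<le> n\<close> these are the arrays whose smallest self-overlap of
  width at least 2 is \<open>i\<close>: narrower overlaps of the array are those of its common end
  pattern.\<close>

definition overlap_class :: "nat \<Rightarrow> nat \<Rightarrow> nat \<Rightarrow> filling set" where
  "overlap_class k n i = (\<Union>Q\<in>min_overlap_patterns i k. ends_with_patterns k n i Q Q)"

lemma overlap_class_iff:
  "P \<in> overlap_class k n i \<longleftrightarrow> P \<in> column_strict_arrays n k \<and>
    red (take i P) \<in> min_overlap_patterns i k \<and> self_overlap P i"
  by (auto simp: overlap_class_def ends_with_patterns_def self_overlap_def column_strict_arrays_def)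

text \<open>The first and the last \<open>i\<close> columns of \<open>P\<close> have the same
  reduction, so the last \<open>b\<close> columns of the prefix reduce like the last
  \<open>b\<close> columns of \<open>P\<close>.\<close>

lemma self_overlap_prefix:
  assumes "self_overlap P i" "b \<le> i" "i \<le> length P"
  shows "self_overlap (red (take i P)) b \<longleftrightarrow> self_overlap P b"
proof -
  have "red (drop (i - b) (red (take i P))) = red (drop (i - b) (drop (length P - i) P))"
    using assms(1) by (metis red_drop_red self_overlap_def)
  moreover have "i - b + (length P - i) = length P - b" using assms by simp
  ultimately show ?thesis using assms(2,3) by (simp add: self_overlap_def min_absorb1)
qed

text \<open>A pattern that is not minimally overlapping belongs to the class of its smallest self-overlap
  \<open>i \<ge> 2\<close>; if \<open>2 * i - n \<ge> 2\<close>, the common columns of the two end blocks would give a smaller one.\<close>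

lemma column_strict_arrays_decomposition:
  assumes n: "n \<ge> 2"
  shows "column_strict_arrays n k =
    min_overlap_patterns n k \<union> (\<Union>i\<in>{2..(n + 1) div 2}. overlap_class k n i)"
proof (intro equalityI subsetI)
  fix P assume P: "P \<in> column_strict_arrays n k"
  note P' = P[unfolded column_strict_arrays_eq_fillings]
  have len: "length P = n" using P by (simp add: column_strict_arrays_def)
  show "P \<in> min_overlap_patterns n k \<union> (\<Union>i\<in>{2..(n + 1) div 2}. overlap_class k n i)"
  proof (cases "P \<in> min_overlap_patterns n k")
    case False
    then have "\<exists>b. 2 \<le> b \<and> b < n \<and> self_overlap P b"
      using P min_overlap_patterns_iff[OF n] by blast
    then obtain i where i: "2 \<le> i" "i < n" "self_overlap P i"
      and least: "\<And>b. b < i \<Longrightarrow> 2 \<le> b \<Longrightarrow> \<not> self_overlap P b"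
      using exists_least_iff[of "\<lambda>b. 2 \<le> b \<and> b < n \<and> self_overlap P b"] by (metis less_trans)
    let ?Q = "red (take i P)"
    have "?Q \<in> column_strict_arrays i k"
      using red_in_column_strict_arrays[OF take_in_fillings[OF P', of i]] i by simp
    moreover have "\<not> self_overlap ?Q b" if "2 \<le> b" "b < i" for b
      using self_overlap_prefix[OF i(3), of b] least that i len by simp
    ultimately have Q: "?Q \<in> min_overlap_patterns i k"
      using min_overlap_patterns_iff[OF i(1)] by blast
    \<comment> \<open>Both end blocks of \<open>P\<close> are matches of \<open>?Q\<close>, at
      distance \<open>n - i\<close>.\<close>
    have m: "match_at ?Q P (Suc 0)" "match_at ?Q P (Suc (n - i))"
      using i len by (simp_all add: match_at_Suc_iff self_overlap_def)
    have "i \<le> (n + 1) div 2"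
    proof (rule ccontr)
      assume "\<not> ?thesis"
      then have "2 \<le> i - (n - i)" "i - (n - i) < i" "n - i < i" using i by auto
      then show False
        using self_overlap_matches[OF m] Q min_overlap_patterns_iff[OF i(1)] i len by auto
    qed
    then show ?thesis using overlap_class_iff P Q i by auto
  qed simp
qed (auto simp: min_overlap_patterns_def overlap_class_iff)

text \<open>The narrower overlap \<open>i\<close> would be a proper self-overlap of the prefix of
  width \<open>j\<close>, which is minimally overlapping.\<close>

lemma overlap_classes_disjoint:
  assumes ij: "2 \<le> i" "i < j" "j \<le> n"
  shows "overlap_class k n i \<inter> overlap_class k n j = {}"
proof -
  have False if P: "P \<in> overlap_class k n i" "P \<in> overlap_class k n j" for P
  proof -
    have "length P = n" using P by (simp add: overlap_class_iff column_strict_arrays_def)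
    then have "self_overlap (red (take j P)) i"
      using self_overlap_prefix[of P j i] P ij by (simp add: overlap_class_iff)
    moreover have "red (take j P) \<in> min_overlap_patterns j k"
      using P by (simp add: overlap_class_iff)
    ultimately show False using min_overlap_patterns_iff[of j] ij by auto
  qed
  then show ?thesis by blast
qed

lemma card_decomposition:
  assumes n: "n \<ge> 2"
  shows "card (column_strict_arrays n k) =
    card (min_overlap_patterns n k) + (\<Sum>i = 2..(n + 1) div 2. card (overlap_class k n i))"
proof -
  let ?I = "{2..(n + 1) div 2}"
  have fin: "finite (overlap_class k n i)" for i
    by (rule finite_subset[OF _ finite_column_strict_arrays[of n k]]) (auto simp: overlap_class_iff)
  have "\<not> P \<in> overlap_class k n i" if "P \<in> min_overlap_patterns n k" "i \<in> ?I" for P i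
  proof -
    \<comment> \<open>The overlap is proper, so it contradicts minimal overlapping; for
      \<open>n = 2\<close> the index range is empty.\<close>
    have "i < n" using that(2) by auto
    then show ?thesis
      using that min_overlap_patterns_iff[OF n] by (auto simp: overlap_class_iff)
  qed
  then have "min_overlap_patterns n k \<inter> (\<Union>i\<in>?I. overlap_class k n i) = {}" by blast
  moreover have "finite (min_overlap_patterns n k)"
    using finite_column_strict_arrays by (simp add: min_overlap_patterns_def)
  ultimately have "card (column_strict_arrays n k) =
      card (min_overlap_patterns n k) + card (\<Union>i\<in>?I. overlap_class k n i)"
    unfolding column_strict_arrays_decomposition[OF n] using fin by (simp add: card_Un_disjoint)
  also have "card (\<Union>i\<in>?I. overlap_class k n i) = (\<Sum>i\<in>?I. card (overlap_class k n i))"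
  proof (rule card_UN_disjoint)
    show "\<forall>i\<in>?I. \<forall>j\<in>?I. i \<noteq> j \<longrightarrow> overlap_class k n i \<inter> overlap_class k n j = {}"
    proof (intro ballI impI)
      fix i j assume "i \<in> ?I" "j \<in> ?I" "i \<noteq> j"
      moreover have "l \<le> n" if "l \<in> ?I" for l using that by auto
      ultimately show "overlap_class k n i \<inter> overlap_class k n j = {}"
        using overlap_classes_disjoint[of i j n k] overlap_classes_disjoint[of j i n k]
        by (cases "i < j") (auto simp: Int_commute)
    qed
  qed (use fin in auto)
  finally show ?thesis .
qed

section \<open>Relative sizes of the classes\<close>

lemma overlap_class_ratio:
  assumes "2 * i \<le> n"
  shows "real (card (overlap_class k n i)) / real (card (column_strict_arrays n k)) =
    min_overlap_ratio i k * (fact k ^ i / fact (i * k))"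
  unfolding overlap_class_def min_overlap_ratio_def
  using assms by (rule card_ends_with_same_pattern) (auto simp: min_overlap_patterns_def)

text \<open>Here \<open>n = 2 * i - 1\<close>, so the end blocks share a column and the independence
  count does not apply; the class is counted by maximum packings with two matches.\<close>

lemma card_overlap_class_middle:
  assumes n: "odd n" "n \<ge> 3" and i: "i = (n + 1) div 2"
  shows "card (overlap_class k n i) = (\<Sum>P\<in>min_overlap_patterns i k. max_packings k P n)"
proof -
  have n': "n = 2 * i - 1" "i \<ge> 2" using n i by presburger+
  have "card (overlap_class k n i) = (\<Sum>P\<in>min_overlap_patterns i k. card (ends_with_patterns k n i P P))"
    unfolding overlap_class_def
    by (rule card_UN_disjoint)
      (auto simp: ends_with_patterns_def min_overlap_patterns_def finite_column_strict_arrays)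
  also have "\<dots> = (\<Sum>P\<in>min_overlap_patterns i k. max_packings k P n)"
  proof (rule sum.cong)
    fix P assume P: "P \<in> min_overlap_patterns i k"
    have "max_packings k P n = card {F \<in> column_strict_arrays n k. mch P F = 2}"
      using max_packings_two n P i by blast
    also have "{F \<in> column_strict_arrays n k. mch P F = 2} = ends_with_patterns k n i P P"
      using two_matches_iff[OF P n'(2)] n'(1) by (auto simp: ends_with_patterns_def)
    finally show "card (ends_with_patterns k n i P P) = max_packings k P n" by simp
  qed simp
  finally show ?thesis .
qed

theorem theorem8:
  fixes n k :: nat
  assumes "k \<ge> 1" and "n \<ge> 2"
  shows "(even n \<longrightarrow>
      min_overlap_ratio n k =
        1 - (\<Sum>i = 2..n div 2. min_overlap_ratio i k * (fact k ^ i / fact (i * k)))) \<and>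
    (odd n \<longrightarrow>
      min_overlap_ratio n k =
        1 - (\<Sum>i = 2..(n - 1) div 2. min_overlap_ratio i k * (fact k ^ i / fact (i * k)))
          - (\<Sum>P \<in> min_overlap_patterns ((n + 1) div 2) k. real (max_packings k P n))
              / real (card (column_strict_arrays n k)))"
proof -
  let ?c = "real (card (column_strict_arrays n k))"
  let ?r = "\<lambda>i. real (card (overlap_class k n i)) / ?c"
  have pos: "?c > 0" by (simp add: card_column_strict_arrays)
  have "?c = real (card (min_overlap_patterns n k))
      + (\<Sum>i = 2..(n + 1) div 2. real (card (overlap_class k n i)))"
    using card_decomposition[OF assms(2), of k] by simp
  \<comment> \<open>The proportions of the minimally overlapping patterns and of the classes add up
    to 1.\<close>
  then have "?c / ?c = min_overlap_ratio n k + (\<Sum>i = 2..(n + 1) div 2. ?r i)"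
    unfolding min_overlap_ratio_def sum_divide_distrib[symmetric] by (metis add_divide_distrib)
  then have main: "min_overlap_ratio n k = 1 - (\<Sum>i = 2..(n + 1) div 2. ?r i)"
    using pos by simp
  show ?thesis
  proof (intro conjI impI)
    assume "even n"
    \<comment> \<open>For even \<open>n\<close> every class in the sum has disjoint end
      blocks.\<close>
    then have "(n + 1) div 2 = n div 2" by simp
    then show "min_overlap_ratio n k =
        1 - (\<Sum>i = 2..n div 2. min_overlap_ratio i k * (fact k ^ i / fact (i * k)))"
      unfolding main by (auto intro!: sum.cong simp: overlap_class_ratio)
  next
    assume "odd n"
    then have n: "n \<ge> 3" "(n + 1) div 2 = Suc ((n - 1) div 2)" "2 \<le> Suc ((n - 1) div 2)"
      using assms(2) by presburger+
    \<comment> \<open>For odd \<open>n\<close> only the last index has end blocks that meet; its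
      class gives the packing term.\<close>
    have "(\<Sum>i = 2..(n + 1) div 2. ?r i) = (\<Sum>i = 2..(n - 1) div 2. ?r i) + ?r ((n + 1) div 2)"
      unfolding n(2) using n(3) by simp
    also have "(\<Sum>i = 2..(n - 1) div 2. ?r i) =
        (\<Sum>i = 2..(n - 1) div 2. min_overlap_ratio i k * (fact k ^ i / fact (i * k)))"
      by (intro sum.cong overlap_class_ratio) auto
    also have "?r ((n + 1) div 2) =
        (\<Sum>P \<in> min_overlap_patterns ((n + 1) div 2) k. real (max_packings k P n)) / ?c"
      using card_overlap_class_middle[OF \<open>odd n\<close> n(1) refl, of k] by simp
    finally show "min_overlap_ratio n k =
        1 - (\<Sum>i = 2..(n - 1) div 2. min_overlap_ratio i k * (fact k ^ i / fact (i * k)))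
          - (\<Sum>P \<in> min_overlap_patterns ((n + 1) div 2) k. real (max_packings k P n)) / ?c"
      unfolding main by simp
  qed
qed

end
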